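(* Let $G$ be a finite directed multigraph with vertex set $\{1,\dots,n+1\}$ ($n\ge1$) having a global sink at $n+1$, with reduced Laplacian $\Delta$. Let $a$ be a stable configuration and let $\sigma$ be a $G$-strongly positive script. Then $a$ is critical if and only if $(a+\sigma\Delta)^o=a$. Moreover, if $a$ is critical, then the firing script of the stabilization of $a+\sigma\Delta$ is $\sigma$.
   Context: Global sink: out-degree of $n+1$ is $0$ and every vertex has a directed path to $n+1$. $d^+_i$ is the out-degree of $i$, $e_{ij}$ the number of edges from $i$ to $j$. $\Delta$ is the $n\times n$ matrix with $\Delta_{ii}=d^+_i$, $\Delta_{ij}=-e_{ij}$ ($i\ne j$), rows $\Delta_i$. A configuration is $a\in\mathbb{Z}^n$; non-negative if all $a_i\ge0$, stable if $0\le a_i\le d^+_i-1$ for all $i$. Vertex $i$ is active in $a$ if $a_i\ge d^+_i$; firing $i$ replaces $a$ by $a-\Delta_i$. A firing sequence is a sequence of vertices each active at the moment it is fired; its firing script $\tau\in\mathbb{Z}_{\ge0}^n$ counts occurrences of each vertex. For a non-negative configuration $c$, any maximal firing sequence from $c$ ends at the same stable configuration $c^o$, and all such sequences have the same firing script (the firing script of the stabilization of $c$). A script is an element of $\mathbb{Z}_{\ge0}^n$. For $x,y\in\mathbb{Z}^n$: $x\succeq y$ means $x_i\ge y_i$ for all $i$; $x\succ y$ means $x\succeq y$ and $x\neq y$; $\operatorname{supp}(x)=\{i: x_i\ne0\}$. A script $\sigma$ is $G$-positive if $\sigma\Delta\succ\vec0$, and $G$-strongly positive if it is $G$-positive and $\operatorname{supp}(\sigma\Delta)$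 meets every strongly connected component of $G$ other than the sink component $\{n+1\}$. Let $a_{\max}=(d^+_1-1,\dots,d^+_n-1)$. A configuration $a$ is critical if it is stable and there exists a non-negative configuration $c$ with $a=(a_{\max}+c)^o$. *)

theory Defs
  imports "HOL-Analysis.Cartesian_Space" "HOL-Analysis.Cartesian_Euclidean_Space"
    "Graph_Theory.Digraph_Component"
begin

text \<open>
  The vertices \<open>1, \<dots>, n\<close> are rendered as the elements of an arbitrary finite type \<open>'n\<close>
  (so \<open>n = CARD('n) \<ge> 1\<close>) and the vertex \<open>n + 1\<close> as \<open>None\<close>; the vertex set is thus
  the whole type \<open>'n option\<close>, and elements of \<open>\<int>\<^sup>n\<close> have type \<open>int ^ 'n\<close>.
  The orders \<open>\<succeq>\<close> and \<open>\<succ>\<close> are the library's componentwise \<open>\<ge>\<close> and \<open>>\<close> on vectors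
  (\<open>x < y\<close> means \<open>x \<le> y\<close> and not \<open>y \<le> x\<close>, i.e. not componentwise strict).
  Loops at the vertices \<open>Some i\<close> are allowed: they count towards the out-degree, hence
  towards the diagonal of the reduced Laplacian, and produce no other entry.
\<close>

definition global_sink :: "('v, 'e) pre_digraph \<Rightarrow> 'v \<Rightarrow> bool" where
  "global_sink G s \<longleftrightarrow> out_degree G s = 0 \<and> (\<forall>v\<in>verts G. reachable G v s)"

definition num_arcs :: "('v, 'e) pre_digraph \<Rightarrow> 'v \<Rightarrow> 'v \<Rightarrow> nat" where
  "num_arcs G u v = card {e \<in> arcs G. tail G e = u \<and> head G e = v}"

definition reduced_laplacian :: "('n::finite option, 'e) pre_digraph \<Rightarrow> int ^ 'n ^ 'n" where
  "reduced_laplacian G =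
     (\<chi> i j. if i = j then int (out_degree G (Some i)) else - int (num_arcs G (Some i) (Some j)))"

definition stable_config :: "('n::finite option, 'e) pre_digraph \<Rightarrow> int ^ 'n \<Rightarrow> bool" where
  "stable_config G a \<longleftrightarrow> (\<forall>i. 0 \<le> a $ i \<and> a $ i \<le> int (out_degree G (Some i)) - 1)"

definition active :: "('n::finite option, 'e) pre_digraph \<Rightarrow> int ^ 'n \<Rightarrow> 'n \<Rightarrow> bool" where
  "active G a i \<longleftrightarrow> a $ i \<ge> int (out_degree G (Some i))"

definition fire :: "('n::finite option, 'e) pre_digraph \<Rightarrow> int ^ 'n \<Rightarrow> 'n \<Rightarrow> int ^ 'n" where
  "fire G a i = a - reduced_laplacian G $ i"

fun firing_sequence :: "('n::finite option, 'e) pre_digraph \<Rightarrow> int ^ 'n \<Rightarrow> 'n list \<Rightarrow> bool" where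
  "firing_sequence G a [] \<longleftrightarrow> True"
| "firing_sequence G a (i # is) \<longleftrightarrow> active G a i \<and> firing_sequence G (fire G a i) is"

definition fire_list :: "('n::finite option, 'e) pre_digraph \<Rightarrow> int ^ 'n \<Rightarrow> 'n list \<Rightarrow> int ^ 'n" where
  "fire_list G a is = foldl (fire G) a is"

definition firing_script :: "'n::finite list \<Rightarrow> int ^ 'n" where
  "firing_script is = (\<chi> i. int (count_list is i))"

definition maximal_firing_sequence ::
    "('n::finite option, 'e) pre_digraph \<Rightarrow> int ^ 'n \<Rightarrow> 'n list \<Rightarrow> bool" where
  "maximal_firing_sequence G a is \<longleftrightarrow>
     firing_sequence G a is \<and> \<not> (\<exists>i. firing_sequence G a (is @ [i]))"

text \<open>The following two are only meaningful for a non-negative configuration \<open>c\<close>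
  on a graph with global sink \<open>None\<close>; there the described object exists and is unique.\<close>

definition stabilization :: "('n::finite option, 'e) pre_digraph \<Rightarrow> int ^ 'n \<Rightarrow> int ^ 'n" where
  "stabilization G c = (THE s. \<exists>is. maximal_firing_sequence G c is \<and> s = fire_list G c is)"

definition stabilization_script :: "('n::finite option, 'e) pre_digraph \<Rightarrow> int ^ 'n \<Rightarrow> int ^ 'n" where
  "stabilization_script G c = (THE \<tau>. \<exists>is. maximal_firing_sequence G c is \<and> \<tau> = firing_script is)"

definition supp :: "int ^ 'n::finite \<Rightarrow> 'n set" where
  "supp x = {i. x $ i \<noteq> 0}"

definition script :: "int ^ 'n::finite \<Rightarrow> bool" where
  "script \<sigma> \<longleftrightarrow> 0 \<le> \<sigma>"

definition positive_script :: "('n::finite option, 'e) pre_digraph \<Rightarrow> int ^ 'n \<Rightarrow> bool" where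
  "positive_script G \<sigma> \<longleftrightarrow> script \<sigma> \<and> \<sigma> v* reduced_laplacian G > 0"

definition strongly_positive_script :: "('n::finite option, 'e) pre_digraph \<Rightarrow> int ^ 'n \<Rightarrow> bool" where
  "strongly_positive_script G \<sigma> \<longleftrightarrow>
     positive_script G \<sigma> \<and>
     (\<forall>C \<in> pre_digraph.sccs_verts G - {{None}}. Some ` supp (\<sigma> v* reduced_laplacian G) \<inter> C \<noteq> {})"

definition a_max :: "('n::finite option, 'e) pre_digraph \<Rightarrow> int ^ 'n" where
  "a_max G = (\<chi> i. int (out_degree G (Some i)) - 1)"

definition critical :: "('n::finite option, 'e) pre_digraph \<Rightarrow> int ^ 'n \<Rightarrow> bool" where
  "critical G a \<longleftrightarrow> stable_config G a \<and> (\<exists>c. 0 \<le> c \<and> a = stabilization G (a_max G + c))"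

end

theory Submission
  imports Defs
begin

text \<open>
  The least action principle bounds every legal script by any script that stabilizes the
  configuration, so stabilizations and their scripts are unique.

  If \<open>a\<close> is the stabilization of \<open>a_max + c\<close>, with script \<open>\<tau>\<close>, then from \<open>a_max + c + \<sigma>\<Delta>\<close> one can
  legally fire \<open>\<sigma>\<close> and then \<open>\<tau>\<close> to reach \<open>a\<close>, but also \<open>\<tau>\<close> first to reach \<open>a + \<sigma>\<Delta>\<close>; by uniqueness
  \<open>a + \<sigma>\<Delta>\<close> stabilizes to \<open>a\<close> with script \<open>\<sigma>\<close>.

  Conversely, if \<open>a + \<sigma>\<Delta>\<close> stabilizes to \<open>a\<close>, then so does \<open>a + k\<sigma>\<Delta>\<close> for every \<open>k\<close>. As the support of
  \<open>\<sigma>\<Delta>\<close> meets every strongly connected component, for large \<open>k\<close> its chips can be spread by legal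
  firings until every vertex holds at least as many as in \<open>a_max\<close>.
\<close>

section \<open>The reduced Laplacian and the sink\<close>

locale sandpile = fin_digraph G for G :: "('n::finite option, 'e) pre_digraph" +
  assumes verts_UNIV: "verts G = UNIV"
    and sink: "global_sink G None"
begin

abbreviation deg :: "'n \<Rightarrow> int" where
  "deg i \<equiv> int (out_degree G (Some i))"

abbreviation laplacian :: "int ^ 'n ^ 'n" (\<open>\<Delta>\<close>) where
  "\<Delta> \<equiv> reduced_laplacian G"

lemma laplacian_diag [simp]: "\<Delta> $ i $ i = deg i"
  by (simp add: reduced_laplacian_def)

lemma laplacian_off_diag: "i \<noteq> j \<Longrightarrow> \<Delta> $ i $ j = - int (num_arcs G (Some i) (Some j))"
  by (simp add: reduced_laplacian_def)

lemma laplacian_off_diag_nonpos: "i \<noteq> j \<Longrightarrow> \<Delta> $ i $ j \<le> 0"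
  by (simp add: laplacian_off_diag)

lemma no_arc_from_sink: "\<not> None \<rightarrow>\<^bsub>G\<^esub> v"
proof
  assume "None \<rightarrow>\<^bsub>G\<^esub> v"
  then obtain e where "e \<in> arcs G" "tail G e = None"
    by (auto simp: arcs_ends_def arc_to_ends_def)
  then have "e \<in> out_arcs G None"
    by simp
  moreover have "out_arcs G None = {}"
    using sink finite_out_arcs by (metis card_eq_0_iff global_sink_def out_degree_def)
  ultimately show False
    by blast
qed

lemma reachable_sink: "v \<rightarrow>\<^sup>*\<^bsub>G\<^esub> None"
  using sink verts_UNIV by (simp add: global_sink_def)

section \<open>A positive potential that every firing lowers\<close>

text \<open>Loops and arcs into the sink are out-arcs of \<open>Some i\<close> without an
  off-diagonal entry; as \<open>w\<close> is nonnegative, dropping them only raises the right-hand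
  side.\<close>

lemma laplacian_apply_ge:
  fixes w :: "'n option \<Rightarrow> int"
  assumes w: "\<And>v. 0 \<le> w v"
  shows "deg i * w (Some i) - (\<Sum>e\<in>out_arcs G (Some i). w (head G e)) \<le> (\<Sum>j\<in>UNIV. \<Delta> $ i $ j * w (Some j))"
proof -
  let ?A = "\<lambda>j. {e \<in> arcs G. tail G e = Some i \<and> head G e = Some j}"
  have "(\<Sum>j\<in>-{i}. int (num_arcs G (Some i) (Some j)) * w (Some j)) = (\<Sum>j\<in>-{i}. \<Sum>e\<in>?A j. w (head G e))"
    by (intro sum.cong) (auto simp: num_arcs_def)
  also have "\<dots> = (\<Sum>e\<in>(\<Union>j\<in>-{i}. ?A j). w (head G e))"
    by (rule sum.UNION_disjoint [symmetric]) auto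
  also have "\<dots> \<le> (\<Sum>e\<in>out_arcs G (Some i). w (head G e))"
    by (rule sum_mono2) (auto simp: w)
  finally have *: "(\<Sum>j\<in>-{i}. int (num_arcs G (Some i) (Some j)) * w (Some j))
      \<le> (\<Sum>e\<in>out_arcs G (Some i). w (head G e))" .
  have "(\<Sum>j\<in>UNIV. \<Delta> $ i $ j * w (Some j)) = deg i * w (Some i) + (\<Sum>j\<in>-{i}. \<Delta> $ i $ j * w (Some j))"
    by (simp add: sum.remove [where x = i] Compl_eq_Diff_UNIV)
  also have "(\<Sum>j\<in>-{i}. \<Delta> $ i $ j * w (Some j)) = - (\<Sum>j\<in>-{i}. int (num_arcs G (Some i) (Some j)) * w (Some j))"
    unfolding sum_negf [symmetric] by (intro sum.cong) (auto simp: laplacian_off_diag)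
  finally show ?thesis
    using * by linarith
qed

text \<open>With \<open>\<delta> v\<close> the distance from \<open>v\<close> to the sink, the weights \<open>K ^ L - K ^ (L - \<delta> v)\<close> are so
  concave in the distance that the one arc approaching the sink outweighs all the others.\<close>

lemma potential_exists:
  obtains w :: "int ^ 'n" where "\<And>i. 0 < w $ i" and "\<And>i. 0 < (\<Delta> *v w) $ i"
proof -
  define \<delta> where "\<delta> v = (LEAST n. (v, None) \<in> arcs_ends G ^^ n)" for v
  have \<delta>: "(v, None) \<in> arcs_ends G ^^ \<delta> v" for v
  proof -
    have "\<exists>n. (v, None) \<in> arcs_ends G ^^ n"
      using reachable_rtranclI [OF reachable_sink] by (simp add: rtrancl_power)
    then show ?thesis
      unfolding \<delta>_def by (rule LeastI_ex)
  qed
  have \<delta>_le: "(v, None) \<in> arcs_ends G ^^ n \<Longrightarrow> \<delta> v \<le> n" for v n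
    unfolding \<delta>_def by (rule Least_le)
  have \<delta>_None: "\<delta> None = 0"
    using \<delta>_le [of None 0] by simp
  have \<delta>_Some: "0 < \<delta> (Some i)" for i
    using \<delta> [of "Some i"] by (cases "\<delta> (Some i)") auto
  define L where "L = Max (range \<delta>)"
  have L: "\<delta> v \<le> L" for v
    unfolding L_def by simp
  \<comment> \<open>At least 2, so that powers grow strictly, and above every out-degree, so that
    \<open>K - deg i\<close> is positive.\<close>
  define K :: int where "K = 2 + (\<Sum>i\<in>UNIV. deg i)"
  have K: "deg i + 2 \<le> K" for i
    unfolding K_def using member_le_sum [of i UNIV deg] by simp
  have K2: "2 \<le> K"
    unfolding K_def by (simp add: sum_nonneg)
  define w where "w v = K ^ L - K ^ (L - \<delta> v)" for v
  have w_nonneg: "0 \<le> w v" for v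
    unfolding w_def using K2 by (simp add: power_increasing)
  have w_pos: "0 < w (Some i)" for i
    unfolding w_def using K2 \<delta>_Some [of i] L [of "Some i"] by (simp add: power_strict_increasing)
  have w_le: "w v \<le> K ^ L" for v
    unfolding w_def using K2 by simp
  have "0 < (\<Sum>j\<in>UNIV. \<Delta> $ i $ j * w (Some j))" for i
  proof -
    obtain k where k: "\<delta> (Some i) = Suc k"
      using \<delta>_Some [of i] by (cases "\<delta> (Some i)") auto
    then obtain u where u: "Some i \<rightarrow>\<^bsub>G\<^esub> u" "(u, None) \<in> arcs_ends G ^^ k"
      using \<delta> [of "Some i"] by (metis relpow_Suc_D2)
    then obtain e where e: "e \<in> out_arcs G (Some i)" "head G e = u"
      by (auto simp: arcs_ends_def arc_to_ends_def)
    have kL: "Suc k \<le> L"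
      using L [of "Some i"] k by simp
    have "w u \<le> K ^ L - K ^ (L - k)"
      unfolding w_def using K2 \<delta>_le [OF u(2)] by (simp add: power_increasing)
    also have "L - k = Suc (L - Suc k)"
      using kL by simp
    finally have wu: "w u \<le> K ^ L - K * K ^ (L - Suc k)"
      by simp
    have "(\<Sum>e\<in>out_arcs G (Some i). w (head G e))
        = w u + (\<Sum>e\<in>out_arcs G (Some i) - {e}. w (head G e))"
      using e sum.remove [OF finite_out_arcs e(1), of "\<lambda>e. w (head G e)"] by simp
    also have "(\<Sum>e\<in>out_arcs G (Some i) - {e}. w (head G e)) \<le> (\<Sum>e\<in>out_arcs G (Some i) - {e}. K ^ L)"
      by (intro sum_mono w_le)
    also have "\<dots> = (deg i - 1) * K ^ L"
    proof -
      have "0 < card (out_arcs G (Some i))"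
        using e(1) by (auto simp: card_gt_0_iff)
      with e(1) show ?thesis
        by (simp add: out_degree_def of_nat_diff)
    qed
    \<comment> \<open>The multiples of \<open>K ^ L\<close> cancel: the arc towards the sink gains
      \<open>K\<close> units of \<open>K ^ (L - Suc k)\<close>, and \<open>w (Some i)\<close> itself
      costs \<open>deg i\<close> of them.\<close>
    finally have "deg i * w (Some i) - (\<Sum>e\<in>out_arcs G (Some i). w (head G e))
        \<ge> (K - deg i) * K ^ (L - Suc k)"
      using wu by (simp add: w_def k algebra_simps)
    moreover have "0 < (K - deg i) * K ^ (L - Suc k)"
      using K [of i] K2 by simp
    ultimately show ?thesis
      using laplacian_apply_ge [of w i] w_nonneg by fastforce
  qed
  then show thesis
    using that [of "\<chi> i. w (Some i)"] w_pos by (simp add: matrix_vector_mult_def)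
qed

lemma script_weight:
  "(\<Sum>j\<in>UNIV. (\<tau> v* \<Delta>) $ j * w $ j) = (\<Sum>i\<in>UNIV. \<tau> $ i * (\<Delta> *v w) $ i)"
  unfolding vector_matrix_mult_def matrix_vector_mult_def vec_lambda_beta sum_distrib_left
    sum_distrib_right mult.assoc
  by (rule sum.swap)

text \<open>Paired with the potential \<open>w\<close>, \<open>\<tau> v* \<Delta>\<close> gives a
  sum that is at most 0, yet it equals a sum of nonnegative terms in which each
  \<open>\<tau> $ i\<close> has a positive weight.\<close>

lemma script_eq_zeroI:
  assumes "0 \<le> \<tau>" "\<tau> v* \<Delta> \<le> 0"
  shows "\<tau> = 0"
proof -
  obtain w :: "int ^ 'n" where w: "\<And>i. 0 < w $ i" "\<And>i. 0 < (\<Delta> *v w) $ i"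
    using potential_exists by blast
  have "(\<Sum>i\<in>UNIV. \<tau> $ i * (\<Delta> *v w) $ i) \<le> 0"
    unfolding script_weight [symmetric] using assms(2) w(1)
    by (intro sum_nonpos mult_nonpos_nonneg) (auto simp: less_eq_vec_def less_imp_le)
  moreover have nn: "0 \<le> \<tau> $ i * (\<Delta> *v w) $ i" for i
    using assms(1) w(2) by (auto simp: less_eq_vec_def less_imp_le intro!: mult_nonneg_nonneg)
  ultimately have "(\<Sum>i\<in>UNIV. \<tau> $ i * (\<Delta> *v w) $ i) = 0"
    by (meson order_antisym sum_nonneg)
  then have "\<tau> $ i * (\<Delta> *v w) $ i = 0" for i
    using nn by (simp add: sum_nonneg_eq_0_iff)
  then show ?thesis
    using w(2) by (metis less_irrefl mult_eq_0_iff vec_eq_iff zero_index)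
qed

lemma axis_laplacian: "axis i k v* \<Delta> = k *s \<Delta> $ i"
  by (simp add: vec_eq_iff vector_matrix_mult_def axis_def if_distrib [of "\<lambda>x. x * _"] cong: if_cong)

text \<open>A vertex that is never fired can only receive chips: the diagonal entry drops out of its
  column.\<close>

lemma script_laplacian_nonpos:
  assumes "0 \<le> \<tau>" "\<tau> $ i = 0"
  shows "(\<tau> v* \<Delta>) $ i \<le> 0"
  unfolding vector_matrix_mult_def using assms
  by (auto simp: less_eq_vec_def intro!: sum_nonpos)
    (metis laplacian_off_diag_nonpos mult_nonneg_nonpos mult_zero_left order_refl)

section \<open>Legal scripts\<close>

text \<open>The configuration reached depends only on the script, so the firing order can be hidden
  and the arguments reduced to vector algebra.\<close>

definition legal :: "int ^ 'n \<Rightarrow> int ^ 'n \<Rightarrow> bool" where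
  "legal c \<tau> \<longleftrightarrow> (\<exists>is. firing_sequence G c is \<and> firing_script is = \<tau>)"

lemma firing_script_Nil [simp]: "firing_script [] = 0"
  by (simp add: firing_script_def vec_eq_iff)

lemma firing_script_Cons [simp]: "firing_script (i # is) = axis i 1 + firing_script is"
  by (simp add: firing_script_def vec_eq_iff axis_def)

lemma fire_eq: "fire G c i = c - axis i 1 v* \<Delta>"
  by (simp add: fire_def axis_laplacian)

lemma fire_list_eq: "fire_list G c is = c - firing_script is v* \<Delta>"
proof (induction "is" arbitrary: c)
  case (Cons i "is")
  then show ?case
    unfolding fire_list_def by (simp add: fire_eq vector_matrix_left_distrib diff_diff_eq)
qed (simp add: fire_list_def)

lemma firing_sequence_append:
  "firing_sequence G c (is @ js) \<longleftrightarrow> firing_sequence G c is \<and> firing_sequence G (fire_list G c is) js"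
  by (induction "is" arbitrary: c) (auto simp: fire_list_def)

lemma firing_script_append: "firing_script (is @ js) = firing_script is + firing_script js"
  by (induction "is") (auto simp: algebra_simps)

lemma firing_script_nonneg: "0 \<le> firing_script is"
  by (simp add: firing_script_def less_eq_vec_def)

lemma legal_nonneg_script: "legal c \<tau> \<Longrightarrow> 0 \<le> \<tau>"
  by (auto simp: legal_def firing_script_nonneg)

lemma legal_0 [simp]: "legal c 0"
  unfolding legal_def by (rule exI [of _ "[]"]) simp

lemma legal_trans: "legal c \<tau> \<Longrightarrow> legal (c - \<tau> v* \<Delta>) \<rho> \<Longrightarrow> legal c (\<tau> + \<rho>)"
  unfolding legal_def using firing_sequence_append fire_list_eq firing_script_append by metis

lemma legal_axis: "active G c i \<Longrightarrow> legal c (axis i 1)"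
  unfolding legal_def by (rule exI [of _ "[i]"]) simp

text \<open>Extra chips never deactivate a vertex, and firing preserves the difference of two
  configurations.\<close>

lemma legal_mono:
  assumes "legal c \<tau>" "c \<le> c'"
  shows "legal c' \<tau>"
proof -
  have "firing_sequence G c is \<Longrightarrow> c \<le> c' \<Longrightarrow> firing_sequence G c' is" for "is"
  proof (induction "is" arbitrary: c c')
    case (Cons i "is")
    moreover have "active G c' i"
      using Cons.prems by (auto simp: active_def less_eq_vec_def intro: order_trans)
    moreover have "fire G c i \<le> fire G c' i"
      using Cons.prems by (simp add: fire_def less_eq_vec_def)
    ultimately show ?case
      by auto
  qed simp
  with assms show ?thesis
    by (auto simp: legal_def)
qed

lemma fire_nonneg:
  assumes "0 \<le> c" "active G c i"
  shows "0 \<le> fire G c i"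
proof -
  have "\<Delta> $ i $ j \<le> c $ j" for j
    using assms laplacian_off_diag_nonpos [of i j]
    by (cases "i = j") (auto simp: active_def less_eq_vec_def intro: order_trans)
  then show ?thesis
    by (simp add: fire_def less_eq_vec_def)
qed

lemma legal_nonneg:
  assumes "legal c \<tau>" "0 \<le> c"
  shows "0 \<le> c - \<tau> v* \<Delta>"
proof -
  have "firing_sequence G c is \<Longrightarrow> 0 \<le> c \<Longrightarrow> 0 \<le> fire_list G c is" for "is"
    by (induction "is" arbitrary: c) (auto simp: fire_list_def fire_nonneg)
  with assms show ?thesis
    by (auto simp: legal_def fire_list_eq)
qed

lemma le_a_max_iff: "c \<le> a_max G \<longleftrightarrow> (\<forall>i. \<not> active G c i)"
  by (auto simp: a_max_def active_def less_eq_vec_def not_le)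

section \<open>Least action, existence and uniqueness of stabilizations\<close>

text \<open>If \<open>\<rho>\<close> did not fire the first vertex \<open>i\<close> of the sequence,
  \<open>i\<close> would lose no chips and stay active after \<open>\<rho>\<close>. So one firing of
  \<open>i\<close> can be cancelled on both sides.\<close>

lemma least_action:
  assumes "legal c \<tau>" "0 \<le> \<rho>" "c - \<rho> v* \<Delta> \<le> a_max G"
  shows "\<tau> \<le> \<rho>"
proof -
  have "firing_sequence G c is \<Longrightarrow> 0 \<le> \<rho> \<Longrightarrow> c - \<rho> v* \<Delta> \<le> a_max G \<Longrightarrow> firing_script is \<le> \<rho>" for "is"
  proof (induction "is" arbitrary: c \<rho>)
    case (Cons i "is")
    have act: "active G c i"
      using Cons.prems by simp
    have "\<rho> $ i \<noteq> 0"
    proof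
      assume "\<rho> $ i = 0"
      then have "active G (c - \<rho> v* \<Delta>) i"
        using script_laplacian_nonpos [OF Cons.prems(2)] act by (fastforce simp: active_def)
      with Cons.prems(3) show False
        by (simp add: le_a_max_iff)
    qed
    then have "0 \<le> \<rho> - axis i 1"
      using Cons.prems(2) by (auto simp: less_eq_vec_def axis_def) (metis order_le_less zless_imp_add1_zle add_0)
    then have "firing_script is \<le> \<rho> - axis i 1"
      using Cons.prems by (intro Cons.IH [of "fire G c i"]) (auto simp: fire_eq algebra_simps)
    then show ?case
      by (simp add: less_eq_vec_def algebra_simps)
  qed simp
  with assms show ?thesis
    by (auto simp: legal_def)
qed

text \<open>The weighted chip count \<open>p\<close> stays nonnegative and drops by the positive
  integer \<open>(\<Delta> *v w) $ i\<close> when \<open>i\<close> fires, so firing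
  terminates.\<close>

lemma legal_stabilizing_exists:
  assumes "0 \<le> c"
  obtains \<tau> where "legal c \<tau>" "c - \<tau> v* \<Delta> \<le> a_max G"
proof -
  obtain w :: "int ^ 'n" where w: "\<And>i. 0 < w $ i" "\<And>i. 0 < (\<Delta> *v w) $ i"
    using potential_exists by blast
  define p where "p c = (\<Sum>j\<in>UNIV. c $ j * w $ j)" for c :: "int ^ 'n"
  have "\<exists>\<tau>. legal c \<tau> \<and> c - \<tau> v* \<Delta> \<le> a_max G"
    using assms
  proof (induction "nat (p c)" arbitrary: c rule: less_induct)
    case less
    show ?case
    proof (cases "c \<le> a_max G")
      case True
      then show ?thesis
        by (intro exI [of _ 0]) simp
    next
      case False
      then obtain i where i: "active G c i"
        by (auto simp: le_a_max_iff)
      have fire: "0 \<le> fire G c i"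
        by (rule fire_nonneg [OF less.prems i])
      have "p (fire G c i) = p c - (\<Delta> *v w) $ i"
        by (simp add: p_def fire_def matrix_vector_mult_def algebra_simps sum_subtractf)
      moreover have "0 \<le> p (fire G c i)"
        unfolding p_def using fire w(1)
        by (intro sum_nonneg mult_nonneg_nonneg) (auto simp: less_eq_vec_def less_imp_le)
      ultimately have "nat (p (fire G c i)) < nat (p c)"
        using w(2) [of i] by simp
      then obtain \<tau> where \<tau>: "legal (fire G c i) \<tau>" "fire G c i - \<tau> v* \<Delta> \<le> a_max G"
        using less.hyps fire by blast
      then have "legal c (axis i 1 + \<tau>)"
        using legal_trans [OF legal_axis [OF i]] by (simp add: fire_eq)
      moreover have "c - (axis i 1 + \<tau>) v* \<Delta> \<le> a_max G"
        using \<tau>(2) by (simp add: fire_eq algebra_simps)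
      ultimately show ?thesis
        by blast
    qed
  qed
  with that show thesis
    by blast
qed

lemma maximal_firing_sequence_iff:
  "maximal_firing_sequence G c is \<longleftrightarrow> firing_sequence G c is \<and> fire_list G c is \<le> a_max G"
  by (auto simp: maximal_firing_sequence_def firing_sequence_append le_a_max_iff)

text \<open>Least action in both directions gives all maximal sequences the script
  \<open>\<tau>\<close>, which makes both definite descriptions meaningful.\<close>

lemma
  assumes "legal c \<tau>" "c - \<tau> v* \<Delta> \<le> a_max G"
  shows stabilization_eqI: "stabilization G c = c - \<tau> v* \<Delta>"
    and stabilization_script_eqI: "stabilization_script G c = \<tau>"
proof -
  obtain js where js: "firing_sequence G c js" "firing_script js = \<tau>"
    using assms(1) by (auto simp: legal_def)
  then have max: "maximal_firing_sequence G c js"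
    using assms(2) by (simp add: maximal_firing_sequence_iff fire_list_eq)
  have unique: "firing_script is = \<tau>" if "maximal_firing_sequence G c is" for "is"
  proof (rule order_antisym)
    have "legal c (firing_script is)" "c - firing_script is v* \<Delta> \<le> a_max G"
      using that by (auto simp: maximal_firing_sequence_iff legal_def fire_list_eq)
    then show "firing_script is \<le> \<tau>" "\<tau> \<le> firing_script is"
      using assms least_action legal_nonneg_script by blast+
  qed
  show "stabilization G c = c - \<tau> v* \<Delta>"
    unfolding stabilization_def using max unique js(2) by (intro the_equality) (auto simp: fire_list_eq)
  show "stabilization_script G c = \<tau>"
    unfolding stabilization_script_def using max unique js(2) by (intro the_equality) auto
qed

section \<open>Critical configurations are fixed\<close>

text \<open>Unless \<open>\<sigma> = 0\<close>, some coordinate \<open>i\<close> of \<open>\<sigma> v* \<Delta>\<close> is positive; such an \<open>i\<close> is active and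
  lies in the support of \<open>\<sigma>\<close>, so it can be fired first.\<close>

lemma legal_above_a_max:
  assumes "0 \<le> c" "0 \<le> \<sigma>"
  shows "legal (a_max G + c + \<sigma> v* \<Delta>) \<sigma>"
  using assms(2)
proof (induction "nat (\<Sum>i\<in>UNIV. \<sigma> $ i)" arbitrary: \<sigma> rule: less_induct)
  case less
  let ?c = "a_max G + c + \<sigma> v* \<Delta>"
  show ?case
  proof (cases "\<sigma> = 0")
    case False
    then have "\<not> \<sigma> v* \<Delta> \<le> 0"
      using script_eq_zeroI less.prems by blast
    then obtain i where i: "0 < (\<sigma> v* \<Delta>) $ i"
      by (auto simp: less_eq_vec_def not_le)
    then have "\<sigma> $ i \<noteq> 0"
      using script_laplacian_nonpos [OF less.prems] by force
    then have pos: "1 \<le> \<sigma> $ i"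
      using less.prems by (simp add: less_eq_vec_def) (metis order_le_less zless_imp_add1_zle add_0)
    \<comment> \<open>\<open>a_max G\<close> is one chip short of activity everywhere, and the
      integer \<open>(\<sigma> v* \<Delta>) $ i\<close> supplies at least one.\<close>
    have act: "active G ?c i"
      using i assms(1) by (simp add: active_def a_max_def less_eq_vec_def add.commute) (smt (verit))
    \<comment> \<open>Firing \<open>i\<close> turns \<open>?c\<close> into the same expression for
      \<open>?\<sigma>\<close>, whose total is smaller by 1.\<close>
    let ?\<sigma> = "\<sigma> - axis i 1"
    have nonneg: "0 \<le> ?\<sigma>"
      using less.prems pos by (auto simp: less_eq_vec_def axis_def)
    have "(\<Sum>j\<in>UNIV. ?\<sigma> $ j) = (\<Sum>j\<in>UNIV. \<sigma> $ j) - 1"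
      by (simp add: sum_subtractf axis_def)
    moreover have "0 \<le> (\<Sum>j\<in>UNIV. ?\<sigma> $ j)"
      using nonneg by (intro sum_nonneg) (simp add: less_eq_vec_def)
    ultimately have "legal (a_max G + c + ?\<sigma> v* \<Delta>) ?\<sigma>"
      using nonneg by (intro less.hyps) auto
    then show ?thesis
      using legal_trans [OF legal_axis [OF act], of ?\<sigma>] by (simp add: algebra_simps)
  qed simp
qed

lemma critical_imp_stabilization:
  assumes "critical G a" "positive_script G \<sigma>"
  shows "stabilization G (a + \<sigma> v* \<Delta>) = a" and "stabilization_script G (a + \<sigma> v* \<Delta>) = \<sigma>"
proof -
  have \<sigma>: "0 \<le> \<sigma>" "0 \<le> \<sigma> v* \<Delta>"
    using assms(2) by (auto simp: positive_script_def script_def)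
  obtain c where c: "0 \<le> c" "a = stabilization G (a_max G + c)" and a: "stable_config G a"
    using assms(1) by (auto simp: critical_def)
  have a_nonneg: "0 \<le> a" and a_le: "a \<le> a_max G"
    using a by (auto simp: stable_config_def a_max_def less_eq_vec_def)
  have "0 \<le> a_max G"
    using a_nonneg a_le by (rule order_trans)
  then have "0 \<le> a_max G + c"
    using c(1) by (simp add: less_eq_vec_def)
  then obtain \<tau> where \<tau>: "legal (a_max G + c) \<tau>" "a_max G + c - \<tau> v* \<Delta> \<le> a_max G"
    by (rule legal_stabilizing_exists)
  then have a_eq: "a = a_max G + c - \<tau> v* \<Delta>"
    using c(2) stabilization_eqI by simp
  \<comment> \<open>Common start of two routes: \<open>\<sigma>\<close> first leads to
    \<open>a_max G + c\<close>, \<open>\<tau>\<close> first leads to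
    \<open>a + \<sigma> v* \<Delta>\<close>.\<close>
  let ?x = "a_max G + c + \<sigma> v* \<Delta>"
  have via_a_max: "legal ?x (\<sigma> + \<tau>)"
    using legal_trans [OF legal_above_a_max [OF c(1) \<sigma>(1)]] \<tau>(1) by simp
  have "0 \<le> a + \<sigma> v* \<Delta>"
    using a_nonneg \<sigma>(2) by (simp add: less_eq_vec_def)
  then obtain \<rho> where \<rho>: "legal (a + \<sigma> v* \<Delta>) \<rho>" "a + \<sigma> v* \<Delta> - \<rho> v* \<Delta> \<le> a_max G"
    by (rule legal_stabilizing_exists)
  have "legal ?x \<tau>"
    using \<tau>(1) by (rule legal_mono) (use \<sigma>(2) in \<open>simp add: less_eq_vec_def\<close>)
  then have via_a: "legal ?x (\<tau> + \<rho>)"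
    using \<rho>(1) by (intro legal_trans) (simp_all add: a_eq algebra_simps)
  \<comment> \<open>Uniqueness is applied to scripts, not configurations:
    \<open>\<rho> = \<sigma>\<close> then yields both claims.\<close>
  have "\<sigma> + \<tau> = \<tau> + \<rho>"
    using stabilization_script_eqI [OF via_a_max] stabilization_script_eqI [OF via_a] a_le \<rho>(2)
    by (simp add: a_eq algebra_simps)
  then have "\<rho> = \<sigma>"
    by simp
  with \<rho> show "stabilization G (a + \<sigma> v* \<Delta>) = a" and "stabilization_script G (a + \<sigma> v* \<Delta>) = \<sigma>"
    by (auto simp: stabilization_eqI stabilization_script_eqI)
qed

section \<open>Gathering chips from many copies of a configuration\<close>

text \<open>Firing \<open>\<tau>\<close> leaves a nonnegative remainder of \<open>c\<close>, so all
  chips of \<open>d\<close> are still there for \<open>\<rho>\<close>.\<close>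

lemma legal_add:
  assumes "legal c \<tau>" "legal d \<rho>" "0 \<le> c" "0 \<le> d"
  shows "legal (c + d) (\<tau> + \<rho>)"
proof (rule legal_trans)
  show "legal (c + d) \<tau>"
    using assms(1) by (rule legal_mono) (use assms(4) in \<open>simp add: less_eq_vec_def\<close>)
  show "legal (c + d - \<tau> v* \<Delta>) \<rho>"
    using assms(2)
    by (rule legal_mono) (use legal_nonneg [OF assms(1,3)] in \<open>simp add: less_eq_vec_def algebra_simps\<close>)
qed

lemma legal_axis_multiple:
  "int m * deg i \<le> c $ i \<Longrightarrow> legal c (axis i (int m))"
proof (induction m arbitrary: c)
  case 0
  have "axis i (int 0) = 0"
    by (simp add: axis_eq_0_iff)
  then show ?case
    by (simp only: legal_0)
next
  case (Suc m)
  have "deg i + int m * deg i \<le> c $ i"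
    using Suc.prems by (simp add: algebra_simps)
  moreover have "0 \<le> int m * deg i"
    by simp
  ultimately have "active G c i"
    unfolding active_def by linarith
  moreover have "legal (c - axis i 1 v* \<Delta>) (axis i (int m))"
    using Suc.prems by (intro Suc.IH) (simp add: axis_laplacian algebra_simps)
  moreover have "axis i (int (Suc m)) = axis i 1 + axis i (int m)"
    by (simp add: vec_eq_iff axis_def)
  ultimately show ?case
    using legal_trans [OF legal_axis] by metis
qed

text \<open>An unbounded supply at \<open>i\<close> from copies of \<open>b\<close>. Since
  \<open>N\<close> is arbitrary, the loss along an arc is offset by a larger request at its
  tail.\<close>

definition accumulates :: "int ^ 'n \<Rightarrow> 'n \<Rightarrow> bool" where
  "accumulates b i \<longleftrightarrow> (\<forall>N. \<exists>k \<tau>. legal (int k *s b) \<tau> \<and> int N \<le> (int k *s b - \<tau> v* \<Delta>) $ i)"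

lemma accumulates_supp:
  assumes "0 \<le> b" "b $ i \<noteq> 0"
  shows "accumulates b i"
  unfolding accumulates_def
proof
  fix N :: nat
  have "1 \<le> b $ i"
    using assms by (simp add: less_eq_vec_def) (metis order_le_less zless_imp_add1_zle add_0)
  then have "int N \<le> int N * b $ i"
    using mult_left_mono by fastforce
  then show "\<exists>k \<tau>. legal (int k *s b) \<tau> \<and> int N \<le> (int k *s b - \<tau> v* \<Delta>) $ i"
    by (intro exI [of _ N] exI [of _ 0]) simp
qed

text \<open>With \<open>N\<close> times its out-degree in chips, \<open>i\<close> can fire
  \<open>N\<close> times, and each firing sends at least one chip to \<open>j\<close>.\<close>

lemma accumulates_step:
  assumes "0 \<le> b" "accumulates b i" "Some i \<rightarrow>\<^bsub>G\<^esub> Some j"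
  shows "accumulates b j"
proof (cases "i = j")
  case False
  have "num_arcs G (Some i) (Some j) \<noteq> 0"
    using assms(3) by (auto simp: num_arcs_def arcs_ends_def arc_to_ends_def)
  then have ij: "\<Delta> $ i $ j \<le> -1"
    using False by (simp add: laplacian_off_diag)
  show ?thesis
    unfolding accumulates_def
  proof
    fix N :: nat
    obtain k \<tau> where \<tau>: "legal (int k *s b) \<tau>"
      and N: "int (N * out_degree G (Some i)) \<le> (int k *s b - \<tau> v* \<Delta>) $ i"
      using assms(2) unfolding accumulates_def by blast
    let ?c = "int k *s b - \<tau> v* \<Delta>"
    have "legal (int k *s b) (\<tau> + axis i (int N))"
      using \<tau> by (rule legal_trans) (use N in \<open>auto intro: legal_axis_multiple\<close>)
    moreover have "0 \<le> int k *s b"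
      using assms(1) by (simp add: less_eq_vec_def)
    then have "0 \<le> ?c $ j"
      using legal_nonneg [OF \<tau>] by (auto simp: less_eq_vec_def)
    moreover have "int N * \<Delta> $ i $ j \<le> int N * (-1)"
      using ij by (intro mult_left_mono) auto
    moreover have "(int k *s b - (\<tau> + axis i (int N)) v* \<Delta>) $ j = ?c $ j - int N * \<Delta> $ i $ j"
      by (simp add: axis_laplacian algebra_simps)
    ultimately show "\<exists>k \<tau>. legal (int k *s b) \<tau> \<and> int N \<le> (int k *s b - \<tau> v* \<Delta>) $ j"
      by (intro exI [of _ k] exI [of _ "\<tau> + axis i (int N)"]) linarith
  qed
qed (use assms in simp)

lemma accumulates_reachable:
  assumes "0 \<le> b" "accumulates b i" "Some i \<rightarrow>\<^sup>*\<^bsub>G\<^esub> Some j"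
  shows "accumulates b j"
proof -
  \<comment> \<open>Vacuous at the sink, which no path leaves, so the induction can range over all
    vertices.\<close>
  have "\<forall>l. v = Some l \<longrightarrow> accumulates b l" if "Some i \<rightarrow>\<^sup>*\<^bsub>G\<^esub> v" for v
    using that
  proof (induction rule: reachable_induct)
    case (step x y)
    then show ?case
      using accumulates_step [OF assms(1)] no_arc_from_sink by (cases x) auto
  qed (use assms(2) in simp)
  with assms(3) show ?thesis
    by blast
qed

text \<open>Vertices are served one at a time, each from fresh copies of \<open>b\<close>, so that
  chips gathered earlier are not spent.\<close>

lemma accumulates_everywhere:
  assumes "0 \<le> b" "\<And>i. accumulates b i"
  obtains k \<tau> where "legal (int k *s b) \<tau>" "a_max G \<le> int k *s b - \<tau> v* \<Delta>"
proof -
  have nonneg: "0 \<le> int k *s b" for k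
    using assms(1) by (simp add: less_eq_vec_def)
  have "\<exists>k \<tau>. legal (int k *s b) \<tau> \<and> (\<forall>i\<in>I. a_max G $ i \<le> (int k *s b - \<tau> v* \<Delta>) $ i)" for I
    using finite [of I]
  proof (induction I rule: finite_induct)
    case empty
    show ?case
      using legal_0 [of "int 0 *s b"] by blast
  next
    case (insert i I)
    obtain k \<tau> where 1: "legal (int k *s b) \<tau>" "\<forall>i\<in>I. a_max G $ i \<le> (int k *s b - \<tau> v* \<Delta>) $ i"
      using insert.IH by blast
    obtain l \<rho> where 2: "legal (int l *s b) \<rho>" "int (nat (a_max G $ i)) \<le> (int l *s b - \<rho> v* \<Delta>) $ i"
      using assms(2) [of i] unfolding accumulates_def by blast
    have eq: "int (k + l) *s b - (\<tau> + \<rho>) v* \<Delta> = (int k *s b - \<tau> v* \<Delta>) + (int l *s b - \<rho> v* \<Delta>)"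
      by (simp add: vec_eq_iff algebra_simps)
    have "legal (int (k + l) *s b) (\<tau> + \<rho>)"
      using legal_add [OF 1(1) 2(1) nonneg nonneg] by (simp add: vec.scale_left_distrib vector_sadd_rdistrib)
    moreover have "0 \<le> (int k *s b - \<tau> v* \<Delta>) $ j" "0 \<le> (int l *s b - \<rho> v* \<Delta>) $ j" for j
      using legal_nonneg [OF 1(1) nonneg] legal_nonneg [OF 2(1) nonneg] by (auto simp: less_eq_vec_def)
    then have "\<forall>j\<in>insert i I. a_max G $ j \<le> (int (k + l) *s b - (\<tau> + \<rho>) v* \<Delta>) $ j"
      unfolding eq vector_add_component using 1(2) 2(2) by (smt (verit) insert_iff int_nat_eq)
    ultimately show ?case
      by blast
  qed
  from this [of UNIV] that show thesis
    by (auto simp: less_eq_vec_def)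
qed

section \<open>Fixed configurations are critical\<close>

text \<open>The copies are absorbed one by one: with an extra \<open>b\<close> the script for
  \<open>k\<close> copies stays legal and ends at \<open>a + b\<close>, from where
  \<open>\<tau>\<close> returns to \<open>a\<close>.\<close>

lemma legal_multiple:
  assumes "0 \<le> b" "legal (a + b) \<tau>" "a + b - \<tau> v* \<Delta> = a"
  obtains \<rho> where "legal (a + int k *s b) \<rho>" "a + int k *s b - \<rho> v* \<Delta> = a"
proof -
  have "\<exists>\<rho>. legal (a + int k *s b) \<rho> \<and> a + int k *s b - \<rho> v* \<Delta> = a"
  proof (induction k)
    case 0
    have "int 0 *s b = 0"
      by (simp add: vec_eq_iff)
    then show ?case
      by (intro exI [of _ 0]) simp
  next
    case (Suc k)
    then obtain \<rho> where \<rho>: "legal (a + int k *s b) \<rho>" "a + int k *s b - \<rho> v* \<Delta> = a"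
      by blast
    have eq: "a + int (Suc k) *s b = a + int k *s b + b"
      by (simp add: vec_eq_iff algebra_simps)
    have "legal (a + int (Suc k) *s b) \<rho>"
      using \<rho>(1) by (rule legal_mono) (use assms(1) in \<open>simp add: eq less_eq_vec_def\<close>)
    moreover have step: "a + int (Suc k) *s b - \<rho> v* \<Delta> = a + b"
      using \<rho>(2) unfolding eq by (simp add: algebra_simps)
    ultimately have "legal (a + int (Suc k) *s b) (\<rho> + \<tau>)"
      using assms(2) by (intro legal_trans) simp_all
    moreover have "a + int (Suc k) *s b - (\<rho> + \<tau>) v* \<Delta> = a"
      using step assms(3) by (simp add: algebra_simps)
    ultimately show ?case
      by blast
  qed
  with that show thesis
    by blast
qed

text \<open>The component of \<open>Some i\<close> differs from \<open>{None}\<close>, so it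
  contains a vertex of the support, and that vertex reaches \<open>Some i\<close>.\<close>

lemma accumulates_strongly_positive:
  assumes "strongly_positive_script G \<sigma>"
  shows "accumulates (\<sigma> v* \<Delta>) i"
proof -
  let ?C = "scc_of (Some i)"
  have "Some i \<in> ?C" "?C \<in> sccs_verts"
    by (simp_all add: in_scc_of_self scc_of_in_sccs_verts verts_UNIV)
  then have "Some ` supp (\<sigma> v* \<Delta>) \<inter> ?C \<noteq> {}"
    using assms by (auto simp: strongly_positive_script_def)
  then obtain j where "(\<sigma> v* \<Delta>) $ j \<noteq> 0" "Some j \<rightarrow>\<^sup>*\<^bsub>G\<^esub> Some i"
    by (auto simp: supp_def scc_of_def)
  moreover have "0 \<le> \<sigma> v* \<Delta>"
    using assms by (simp add: strongly_positive_script_def positive_script_def less_imp_le)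
  ultimately show ?thesis
    using accumulates_supp accumulates_reachable by blast
qed

lemma stabilization_imp_critical:
  assumes a: "stable_config G a" and \<sigma>: "strongly_positive_script G \<sigma>"
    and fixed: "stabilization G (a + \<sigma> v* \<Delta>) = a"
  shows "critical G a"
proof -
  define b where "b = \<sigma> v* \<Delta>"
  have a_nonneg: "0 \<le> a" and a_le: "a \<le> a_max G"
    using a by (auto simp: stable_config_def a_max_def less_eq_vec_def)
  have b: "0 \<le> b"
    using \<sigma> by (simp add: strongly_positive_script_def positive_script_def b_def less_imp_le)
  then have "0 \<le> a + b"
    using a_nonneg by (simp add: less_eq_vec_def)
  then obtain \<rho> where \<rho>: "legal (a + b) \<rho>" "a + b - \<rho> v* \<Delta> \<le> a_max G"
    by (rule legal_stabilizing_exists)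
  then have \<rho>_a: "a + b - \<rho> v* \<Delta> = a"
    using stabilization_eqI fixed b_def by metis
  obtain k \<tau> where \<tau>: "legal (int k *s b) \<tau>" "a_max G \<le> int k *s b - \<tau> v* \<Delta>"
    using accumulates_everywhere [OF b] accumulates_strongly_positive [OF \<sigma>] b_def by metis
  let ?x = "a + int k *s b"
  \<comment> \<open>The surplus over \<open>a_max G\<close> after gathering with
    \<open>\<tau>\<close>: the witness for criticality.\<close>
  let ?c = "?x - \<tau> v* \<Delta> - a_max G"
  have x\<tau>: "legal ?x \<tau>"
    using \<tau>(1) by (rule legal_mono) (use a_nonneg in \<open>simp add: less_eq_vec_def\<close>)
  obtain \<rho>' where \<rho>': "legal ?x \<rho>'" "?x - \<rho>' v* \<Delta> = a"
    using legal_multiple [OF b \<rho>(1) \<rho>_a] .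
  have c: "0 \<le> ?c"
    using \<tau>(2) a_nonneg by (simp add: less_eq_vec_def algebra_simps) (smt (verit))
  then have "0 \<le> a_max G + ?c"
    using order_trans [OF a_nonneg a_le] by (simp add: less_eq_vec_def) (smt (verit))
  then obtain \<mu> where \<mu>: "legal (a_max G + ?c) \<mu>" "a_max G + ?c - \<mu> v* \<Delta> \<le> a_max G"
    by (rule legal_stabilizing_exists)
  \<comment> \<open>Stabilizing \<open>?x\<close> by way of \<open>a_max G + ?c\<close> must give
    the same result as absorbing the copies of \<open>b\<close> with \<open>\<rho>'\<close>, namely
    \<open>a\<close>.\<close>
  have "legal ?x (\<tau> + \<mu>)"
    using x\<tau> by (rule legal_trans) (use \<mu>(1) in \<open>simp add: algebra_simps\<close>)
  moreover have eq: "?x - (\<tau> + \<mu>) v* \<Delta> = a_max G + ?c - \<mu> v* \<Delta>"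
    by (simp add: algebra_simps)
  ultimately have "stabilization G ?x = a_max G + ?c - \<mu> v* \<Delta>"
    using stabilization_eqI [of ?x "\<tau> + \<mu>"] \<mu>(2) by metis
  moreover have "stabilization G ?x = a"
    using stabilization_eqI [OF \<rho>'(1)] \<rho>'(2) a_le by simp
  ultimately have "a = stabilization G (a_max G + ?c)"
    using stabilization_eqI [OF \<mu>] by simp
  with a c show ?thesis
    unfolding critical_def by blast
qed

end

theorem theorem3p5:
  fixes G :: "('n::finite option, 'e) pre_digraph"
    and a \<sigma> :: "int ^ 'n"
  assumes "fin_digraph G"
    and "verts G = UNIV"
    and "global_sink G None"
    and "stable_config G a"
    and "strongly_positive_script G \<sigma>"
  shows "(critical G a \<longleftrightarrow> stabilization G (a + \<sigma> v* reduced_laplacian G) = a) \<and>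
         (critical G a \<longrightarrow> stabilization_script G (a + \<sigma> v* reduced_laplacian G) = \<sigma>)"
proof -
  interpret sandpile G
    using assms(1-3) by (intro sandpile.intro sandpile_axioms.intro)
  have "positive_script G \<sigma>"
    using assms(5) by (simp add: strongly_positive_script_def)
  then show ?thesis
    using critical_imp_stabilization stabilization_imp_critical [OF assms(4,5)] by blast
qed

end
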